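(* Let $a_1,a_2,\ldots$ be an arbitrary sequence of points of $\mathbb{T}$, let $t\in\mathbb{T}$, and let $f$ be a positive function decreasing monotonically to $0$ (arbitrarily slowly). Then there exists a function $h:\mathbb{T}\to\mathbb{C}$ which is continuous and differentiable on $\mathbb{T}$ and is $C^\infty$ on $\mathbb{T}\setminus\{t\}$, such that for infinitely many positive integers $n$, \[ \left|\frac1n\sum_{j=1}^n h(a_j)-\int_{\mathbb{T}} h\right|\ \ge\ f(n). \]
   Context: $\mathbb{T}=\mathbb{R}/\mathbb{Z}$ with Haar (Lebesgue) measure, identified with $[0,1)$. *)

theory Defs
  imports "HOL-Analysis.Analysis" "HOL-Library.Periodic_Fun"
begin

text \<open>
  The circle is \<open>\<real> / \<int>\<close>: its points are given by real representatives, its functions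
  are the functions on the reals with period 1 (\<^locale>\<open>periodic_fun_simple'\<close>), and
  Haar measure is Lebesgue measure on the fundamental domain \<open>[0, 1)\<close>.
\<close>

text \<open>The preimage in the reals of the circle without the class of \<open>t\<close>.\<close>

definition punctured_circle :: "real \<Rightarrow> real set" where
  "punctured_circle t = {x. x - t \<notin> \<int>}"

primrec nth_vector_derivative :: "nat \<Rightarrow> (real \<Rightarrow> 'a::real_normed_vector) \<Rightarrow> real \<Rightarrow> 'a" where
  "nth_vector_derivative 0 h = h"
| "nth_vector_derivative (Suc k) h = (\<lambda>x. vector_derivative (nth_vector_derivative k h) (at x))"

text \<open>
  Meant for open \<open>S\<close>, where it says that derivatives of all orders exist (and hence are
  continuous) on \<open>S\<close>; values of the iterated derivatives outside \<open>S\<close> are then irrelevant.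
\<close>

definition C_infinity_on :: "(real \<Rightarrow> 'a::real_normed_vector) \<Rightarrow> real set \<Rightarrow> bool" where
  "C_infinity_on h S \<longleftrightarrow> (\<forall>k. \<forall>x\<in>S. nth_vector_derivative k h differentiable (at x))"

end

theory Submission
  imports Defs
begin

text \<open>
  The function is a series of nonnegative bumps \<open>g k\<close> contracting to \<open>t\<close>, where
  \<open>g k \<le> 2 ^ (- k) * sin\<^sup>2 (pi * (x - t))\<close> vanishes at \<open>a 1, \<dots>, a (n k)\<close>. So every bump from
  the \<open>k\<close>-th on contributes \<open>0\<close> to the \<open>n k\<close>-th average while its integral is nonnegative, and
  the discrepancies of these bumps cannot cancel. The integral of \<open>g k\<close> is bounded below by some
  \<open>b k\<close> that depends on \<open>k\<close> only, because removing neighbourhoods of finitely many points costs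
  arbitrarily little mass; hence \<open>n k\<close> may be taken so large that \<open>f (n k)\<close> is small
  compared with \<open>b k\<close>. The partial sums of the series are smooth on the whole circle: either one of
  them already has large discrepancy infinitely often, or they are negligible for large \<open>n k\<close>.
\<close>

section \<open>Functions with derivatives of all orders\<close>

text \<open>The derivative is an existential witness required only on \<open>S\<close>, and the
  recursion strips the first derivative. Sum, product and chain rule then become plain inductions on
  the order, with the functions generalised.\<close>

primrec times_differentiable_on :: "nat \<Rightarrow> (real \<Rightarrow> 'a::real_normed_vector) \<Rightarrow> real set \<Rightarrow> bool" where
  "times_differentiable_on 0 f S \<longleftrightarrow> True"
| "times_differentiable_on (Suc k) f S \<longleftrightarrow>
    (\<exists>f'. (\<forall>x\<in>S. (f has_vector_derivative f' x) (at x)) \<and> times_differentiable_on k f' S)"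

lemma times_differentiable_on_Suc_imp:
  "times_differentiable_on (Suc k) f S \<Longrightarrow> times_differentiable_on k f S"
  by (induction k arbitrary: f) auto

lemma times_differentiable_on_subset:
  "times_differentiable_on k f S \<Longrightarrow> T \<subseteq> S \<Longrightarrow> times_differentiable_on k f T"
  by (induction k arbitrary: f) (simp, fastforce)

lemma times_differentiable_on_cong:
  assumes "times_differentiable_on k f S" "open S" "\<And>x. x \<in> S \<Longrightarrow> f x = g x"
  shows "times_differentiable_on k g S"
proof (cases k)
  case (Suc m)
  then show ?thesis
    using assms by (auto intro: has_vector_derivative_transform_within_open)
qed simp

lemma times_differentiable_on_const: "times_differentiable_on k (\<lambda>_. c) S"
proof (induction k arbitrary: c)
  case (Suc k)
  then show ?case by (auto intro!: exI[of _ "\<lambda>_. 0"])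
qed simp

lemma times_differentiable_on_add:
  assumes "times_differentiable_on k f S" "times_differentiable_on k g S"
  shows "times_differentiable_on k (\<lambda>x. f x + g x) S"
  using assms
proof (induction k arbitrary: f g)
  case (Suc k)
  then obtain f' g' where
    "\<forall>x\<in>S. (f has_vector_derivative f' x) (at x)" "times_differentiable_on k f' S"
    "\<forall>x\<in>S. (g has_vector_derivative g' x) (at x)" "times_differentiable_on k g' S"
    by auto
  with Suc.IH show ?case
    by (auto intro!: exI[of _ "\<lambda>x. f' x + g' x"] has_vector_derivative_add)
qed simp

text \<open>The product rule brings back \<open>f\<close> and \<open>g\<close> themselves beside
  their derivatives, so the induction first lowers both to order \<open>k\<close>.\<close>

lemma times_differentiable_on_mult:
  fixes f g :: "real \<Rightarrow> real"
  assumes "times_differentiable_on k f S" "times_differentiable_on k g S"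
  shows "times_differentiable_on k (\<lambda>x. f x * g x) S"
  using assms
proof (induction k arbitrary: f g)
  case (Suc k)
  then obtain f' g' where d:
    "\<forall>x\<in>S. (f has_vector_derivative f' x) (at x)" "times_differentiable_on k f' S"
    "\<forall>x\<in>S. (g has_vector_derivative g' x) (at x)" "times_differentiable_on k g' S"
    by auto
  have "times_differentiable_on k f S" "times_differentiable_on k g S"
    using Suc.prems times_differentiable_on_Suc_imp by blast+
  then have "times_differentiable_on k (\<lambda>x. f x * g' x + f' x * g x) S"
    using d by (intro times_differentiable_on_add Suc.IH)
  with d show ?case
    by (auto intro!: exI[of _ "\<lambda>x. f x * g' x + f' x * g x"] has_vector_derivative_mult)
qed simp

text \<open>In the chain rule the induction hypothesis handles the outer derivative composed with
  \<open>g\<close>, taken at order \<open>k\<close>; the product lemma supplies the remaining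
  factor.\<close>

lemma times_differentiable_on_compose:
  fixes f g :: "real \<Rightarrow> real"
  assumes "times_differentiable_on k f UNIV" "times_differentiable_on k g S"
  shows "times_differentiable_on k (\<lambda>x. f (g x)) S"
  using assms
proof (induction k arbitrary: f g)
  case (Suc k)
  then obtain f' g' where d:
    "\<forall>x. (f has_vector_derivative f' x) (at x)" "times_differentiable_on k f' UNIV"
    "\<forall>x\<in>S. (g has_vector_derivative g' x) (at x)" "times_differentiable_on k g' S"
    by auto
  have "times_differentiable_on k g S"
    using Suc.prems times_differentiable_on_Suc_imp by blast
  then have "times_differentiable_on k (\<lambda>x. f' (g x) * g' x) S"
    using times_differentiable_on_mult[OF Suc.IH[OF d(2)] d(4)] by blast
  moreover have "((\<lambda>x. f (g x)) has_vector_derivative f' (g x) * g' x) (at x)" if "x \<in> S" for x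
    using d that DERIV_chain2[of f "f' (g x)" g x "g' x" UNIV]
    by (simp add: has_real_derivative_iff_has_vector_derivative)
  ultimately show ?case
    by (auto intro!: exI[of _ "\<lambda>x. f' (g x) * g' x"])
qed simp

lemma times_differentiable_on_of_real:
  "times_differentiable_on k f S \<Longrightarrow> times_differentiable_on k (\<lambda>x. complex_of_real (f x)) S"
proof (induction k arbitrary: f)
  case (Suc k)
  then obtain f' where d:
    "\<forall>x\<in>S. (f has_vector_derivative f' x) (at x)" "times_differentiable_on k f' S"
    by auto
  with Suc.IH show ?case
    by (auto intro!: exI[of _ "\<lambda>x. complex_of_real (f' x)"] has_vector_derivative_of_real
        simp: has_real_derivative_iff_has_vector_derivative)
qed simp

text \<open>The definition of \<open>nth_vector_derivative\<close> adds derivatives on the outside;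
  moving one to the inside matches the recursion of \<open>times_differentiable_on\<close>.\<close>

lemma nth_vector_derivative_Suc_left:
  "nth_vector_derivative (Suc k) h = nth_vector_derivative k (\<lambda>x. vector_derivative h (at x))"
proof (induction k)
  case (Suc k)
  show ?case
    by (subst nth_vector_derivative.simps(2), subst Suc) simp
qed simp

text \<open>The witness derivative agrees with \<open>vector_derivative\<close> only on
  \<open>S\<close>. Openness of \<open>S\<close> makes this agreement hold near each point, so
  higher derivatives may be computed from either. Differentiability of the \<open>k\<close>-th
  derivative takes one order more, hence \<open>Suc k\<close>.\<close>

lemma times_differentiable_on_imp_differentiable:
  assumes "times_differentiable_on (Suc k) h S" "open S" "x \<in> S"
  shows "nth_vector_derivative k h differentiable (at x)"
  using assms(1)
proof (induction k arbitrary: h)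
  case 0
  with assms show ?case
    by (auto simp: differentiable_def has_vector_derivative_def)
next
  case (Suc k)
  then obtain h' where h': "\<forall>x\<in>S. (h has_vector_derivative h' x) (at x)"
    "times_differentiable_on (Suc k) h' S"
    by auto
  have "times_differentiable_on (Suc k) (\<lambda>x. vector_derivative h (at x)) S"
    using h' by (intro times_differentiable_on_cong[OF h'(2) assms(2)]) (auto simp: vector_derivative_at)
  then show ?case
    unfolding nth_vector_derivative_Suc_left by (rule Suc.IH)
qed

definition smooth_on :: "(real \<Rightarrow> 'a::real_normed_vector) \<Rightarrow> real set \<Rightarrow> bool" where
  "smooth_on f S \<longleftrightarrow> (\<forall>k. times_differentiable_on k f S)"

lemma smooth_on_const: "smooth_on (\<lambda>_. c) S"
  by (simp add: smooth_on_def times_differentiable_on_const)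

lemma smooth_on_add: "smooth_on f S \<Longrightarrow> smooth_on g S \<Longrightarrow> smooth_on (\<lambda>x. f x + g x) S"
  by (simp add: smooth_on_def times_differentiable_on_add)

lemma smooth_on_mult:
  fixes f g :: "real \<Rightarrow> real"
  shows "smooth_on f S \<Longrightarrow> smooth_on g S \<Longrightarrow> smooth_on (\<lambda>x. f x * g x) S"
  by (simp add: smooth_on_def times_differentiable_on_mult)

lemma smooth_on_compose:
  fixes f g :: "real \<Rightarrow> real"
  shows "smooth_on f UNIV \<Longrightarrow> smooth_on g S \<Longrightarrow> smooth_on (\<lambda>x. f (g x)) S"
  by (simp add: smooth_on_def times_differentiable_on_compose)

lemma smooth_on_of_real: "smooth_on f S \<Longrightarrow> smooth_on (\<lambda>x. complex_of_real (f x)) S"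
  by (simp add: smooth_on_def times_differentiable_on_of_real)

lemma smooth_on_subset: "smooth_on f S \<Longrightarrow> T \<subseteq> S \<Longrightarrow> smooth_on f T"
  using times_differentiable_on_subset unfolding smooth_on_def by metis

lemma smooth_on_cong:
  "smooth_on f S \<Longrightarrow> open S \<Longrightarrow> (\<And>x. x \<in> S \<Longrightarrow> f x = g x) \<Longrightarrow> smooth_on g S"
  unfolding smooth_on_def by (metis times_differentiable_on_cong)

lemma smooth_on_diff:
  fixes f g :: "real \<Rightarrow> real"
  assumes "smooth_on f S" "smooth_on g S"
  shows "smooth_on (\<lambda>x. f x - g x) S"
  using smooth_on_add[OF assms(1) smooth_on_mult[OF smooth_on_const[of "-1"] assms(2)]] by simp

lemma smooth_on_power:
  fixes f :: "real \<Rightarrow> real"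
  shows "smooth_on f S \<Longrightarrow> smooth_on (\<lambda>x. f x ^ n) S"
  by (induction n) (auto intro: smooth_on_const smooth_on_mult)

lemma smooth_on_prod:
  fixes f :: "'i \<Rightarrow> real \<Rightarrow> real"
  assumes "\<And>i. i \<in> I \<Longrightarrow> smooth_on (f i) S"
  shows "smooth_on (\<lambda>x. \<Prod>i\<in>I. f i x) S"
  using assms
  by (induction I rule: infinite_finite_induct) (auto intro: smooth_on_const smooth_on_mult)

lemma smooth_on_imp_differentiable:
  "smooth_on h S \<Longrightarrow> open S \<Longrightarrow> x \<in> S \<Longrightarrow> h differentiable (at x)"
  using times_differentiable_on_imp_differentiable[of 0 h S x] unfolding smooth_on_def by simp

lemma smooth_on_imp_continuous_on:
  assumes "smooth_on h UNIV"
  shows "continuous_on UNIV h"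
  using smooth_on_imp_differentiable[OF assms] 
  by (auto intro!: continuous_at_imp_continuous_on differentiable_imp_continuous_within)

lemma smooth_on_imp_C_infinity_on: "smooth_on h S \<Longrightarrow> open S \<Longrightarrow> C_infinity_on h S"
  unfolding smooth_on_def C_infinity_on_def
  by (blast intro: times_differentiable_on_imp_differentiable)

section \<open>Smooth building blocks: the cosine and the flat exponential\<close>

lemma smooth_on_cos_linear: "smooth_on (\<lambda>x. cos (c * x + d) :: real) S"
proof -
  have "times_differentiable_on k (\<lambda>x. cos (c * x + d) :: real) S" for k
  proof (induction k arbitrary: d)
    case (Suc k)
    \<comment> \<open>Differentiation shifts the phase by \<open>pi / 2\<close> and multiplies by
      \<open>c\<close>, so with \<open>d\<close> generalised the family is closed under it.\<close>
    have "times_differentiable_on k (\<lambda>x. c * cos (c * x + (d + pi / 2))) S"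
      by (intro times_differentiable_on_mult times_differentiable_on_const Suc)
    moreover have "((\<lambda>x. cos (c * x + d)) has_vector_derivative c * cos (c * x + (d + pi / 2))) (at x)" for x
    proof -
      have "cos (c * x + (d + pi / 2)) = - sin (c * x + d)"
        by (simp add: cos_add flip: add.assoc)
      then show ?thesis
        unfolding has_real_derivative_iff_has_vector_derivative[symmetric]
        by (auto intro!: derivative_eq_intros)
    qed
    ultimately show ?case
      by (auto intro!: exI[of _ "\<lambda>x. c * cos (c * x + (d + pi / 2))"])
  qed simp
  then show ?thesis by (simp add: smooth_on_def)
qed

text \<open>For \<open>m = 0\<close> this is the classical smooth function that is flat at 0. The
  powers in the denominator make the family closed under differentiation up to linear combinations,
  so all orders follow by one induction over arbitrary \<open>m\<close>.\<close>

definition flat_exp :: "nat \<Rightarrow> real \<Rightarrow> real" where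
  "flat_exp m y = (if y > 0 then exp (- 1 / y) / y ^ m else 0)"

text \<open>Under \<open>z = inverse y\<close> this is the decay of \<open>z ^ m / exp z\<close> at
  infinity.\<close>

lemma flat_exp_at_right_0: "(flat_exp m \<longlongrightarrow> 0) (at_right 0)"
proof -
  have "((\<lambda>z::real. z ^ m / exp z) \<longlongrightarrow> 0) at_top"
    by (rule tendsto_power_div_exp_0)
  then have "((\<lambda>y::real. inverse y ^ m / exp (inverse y)) \<longlongrightarrow> 0) (at_right 0)"
    by (rule filterlim_compose[OF _ filterlim_inverse_at_top_right])
  moreover have "\<forall>\<^sub>F y in at_right 0. inverse y ^ m / exp (inverse y) = flat_exp m y"
    using eventually_at_right_less[of "0::real"]
    by eventually_elim (simp add: flat_exp_def exp_minus field_simps)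
  ultimately show ?thesis
    by (rule Lim_transform_eventually)
qed

lemma flat_exp_has_derivative:
  "(flat_exp m has_field_derivative flat_exp (m + 2) y - m * flat_exp (m + 1) y) (at y)"
proof -
  consider "y > 0" | "y < 0" | "y = 0" by linarith
  then show ?thesis
  proof cases
    case 1
    have "((\<lambda>y. exp (- 1 / y) / y ^ m) has_field_derivative
        (exp (- 1 / y) * (1 / y\<^sup>2) * y ^ m - exp (- 1 / y) * (m * y ^ (m - 1))) / (y ^ m * y ^ m)) (at y)"
      using 1 by (auto intro!: derivative_eq_intros simp: power2_eq_square)
    moreover have "(exp (- 1 / y) * (1 / y\<^sup>2) * y ^ m - exp (- 1 / y) * (m * y ^ (m - 1))) / (y ^ m * y ^ m)
        = flat_exp (m + 2) y - m * flat_exp (m + 1) y"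
      \<comment> \<open>The case \<open>m = 0\<close> is separate because \<open>m - 1\<close>
        truncates there.\<close>
      using 1 by (cases m) (simp_all add: flat_exp_def field_simps power2_eq_square)
    ultimately have "((\<lambda>y. exp (- 1 / y) / y ^ m) has_field_derivative
        flat_exp (m + 2) y - m * flat_exp (m + 1) y) (at y)"
      by simp
    then show ?thesis
      by (rule has_field_derivative_transform_within_open[of _ _ _ "{0<..}"])
        (use 1 in \<open>auto simp: flat_exp_def\<close>)
  next
    case 2
    have "((\<lambda>y. 0) has_field_derivative flat_exp (m + 2) y - m * flat_exp (m + 1) y) (at y)"
      using 2 by (simp add: flat_exp_def)
    then show ?thesis
      by (rule has_field_derivative_transform_within_open[of _ _ _ "{..<0}"])
        (use 2 in \<open>auto simp: flat_exp_def\<close>)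
  next
    case 3
    \<comment> \<open>The difference quotient at 0 is zero on the left and
      \<open>flat_exp (Suc m)\<close> on the right, which tends to 0 by the preceding lemma.\<close>
    have "((\<lambda>h. flat_exp m h / h) \<longlongrightarrow> 0) (at 0)"
    proof (rule filterlim_split_at_real)
      have "\<forall>\<^sub>F h in at_left 0. 0 = flat_exp m h / h"
        by (auto simp: eventually_at_left_field flat_exp_def intro: exI[of _ "-1"])
      then show "((\<lambda>h. flat_exp m h / h) \<longlongrightarrow> 0) (at_left 0)"
        by (rule Lim_transform_eventually[OF tendsto_const])
      have "\<forall>\<^sub>F h in at_right 0. flat_exp (Suc m) h = flat_exp m h / h"
        using eventually_at_right_less[of "0::real"] 
        by eventually_elim (simp add: flat_exp_def)
      then show "((\<lambda>h. flat_exp m h / h) \<longlongrightarrow> 0) (at_right 0)"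
        by (rule Lim_transform_eventually[OF flat_exp_at_right_0])
    qed
    then show ?thesis
      using 3 by (simp add: DERIV_def flat_exp_def)
  qed
qed

lemma smooth_on_flat_exp: "smooth_on (flat_exp m) S"
proof -
  have "times_differentiable_on k (flat_exp m) S" for k
  proof (induction k arbitrary: m)
    case (Suc k)
    have "times_differentiable_on k (\<lambda>y. flat_exp (m + 2) y + (- real m) * flat_exp (m + 1) y) S"
      by (intro times_differentiable_on_add times_differentiable_on_mult times_differentiable_on_const Suc)
    then show ?case
      using flat_exp_has_derivative[of m]
      by (auto intro!: exI[of _ "\<lambda>y. flat_exp (m + 2) y + (- real m) * flat_exp (m + 1) y"]
          simp: has_real_derivative_iff_has_vector_derivative)
  qed simp
  then show ?thesis by (simp add: smooth_on_def)
qed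

section \<open>The bumps\<close>

text \<open>A smooth substitute for the squared distance to \<open>c\<close> on the circle: it has
  period 1, lies in \<open>[0, 1]\<close> and has its zeros, of second order, exactly at
  \<open>c\<close> modulo integers.\<close>

definition sin_dist :: "real \<Rightarrow> real \<Rightarrow> real" where
  "sin_dist c x = (sin (pi * (x - c)))\<^sup>2"

lemma sin_dist_nonneg: "0 \<le> sin_dist c x"
  by (simp add: sin_dist_def)

lemma sin_dist_le_1: "sin_dist c x \<le> 1"
  unfolding sin_dist_def by (simp add: abs_square_le_1)

lemma sin_dist_self [simp]: "sin_dist c c = 0"
  by (simp add: sin_dist_def)

lemma sin_dist_plus_1 [simp]: "sin_dist c (x + 1) = sin_dist c x"
proof -
  have "pi * (x + 1 - c) = pi * (x - c) + pi" by (simp add: algebra_simps)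
  then show ?thesis by (simp add: sin_dist_def)
qed

lemma sin_dist_eq_0_iff: "sin_dist c x = 0 \<longleftrightarrow> x - c \<in> \<int>"
  by (simp add: sin_dist_def sin_zero_iff_int2 Ints_def image_iff mult.commute[of pi])

lemma smooth_on_sin_dist: "smooth_on (sin_dist c) S"
proof -
  have "sin (pi * (x - c)) = cos (pi * x + (- pi * c - pi / 2))" for x
  proof -
    have "pi * x + (- pi * c - pi / 2) = pi * (x - c) - pi / 2" by (simp add: algebra_simps)
    then show ?thesis by (simp only: cos_diff) simp
  qed
  then have "sin_dist c = (\<lambda>x. cos (pi * x + (- pi * c - pi / 2)) ^ 2)"
    by (simp add: sin_dist_def fun_eq_iff)
  then show ?thesis
    using smooth_on_power[OF smooth_on_cos_linear] by metis
qed

lemma continuous_on_sin_dist: "continuous_on S (sin_dist c)"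
  unfolding sin_dist_def by (intro continuous_intros)

lemma sin_dist_has_derivative:
  "(sin_dist c has_field_derivative 2 * pi * sin (pi * (x - c)) * cos (pi * (x - c))) (at x)"
  unfolding sin_dist_def by (rule derivative_eq_intros refl | simp)+

text \<open>Each factor has one task: \<open>(1 / 2) ^ k\<close> gives summability,
  \<open>sin_dist t x\<close> forces quadratic vanishing at \<open>t\<close>, and the flat
  exponential cuts the support smoothly down to where \<open>sin_dist t x\<close> is below
  \<open>(1 / 2) ^ k\<close>.\<close>

definition bump :: "real \<Rightarrow> nat \<Rightarrow> real \<Rightarrow> real" where
  "bump t k x = (1 / 2) ^ k * sin_dist t x * flat_exp 0 ((1 / 2) ^ k - sin_dist t x)"

lemma bump_nonneg: "0 \<le> bump t k x"
  and bump_le: "bump t k x \<le> (1 / 2) ^ k * sin_dist t x"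
proof -
  have e: "0 \<le> flat_exp 0 y" "flat_exp 0 y \<le> 1" for y
    by (auto simp: flat_exp_def)
  show "0 \<le> bump t k x"
    by (simp add: bump_def e sin_dist_nonneg)
  show "bump t k x \<le> (1 / 2) ^ k * sin_dist t x"
    unfolding bump_def by (rule mult_left_le) (simp_all add: e sin_dist_nonneg)
qed

lemma bump_eq_0: "(1 / 2) ^ k \<le> sin_dist t x \<Longrightarrow> bump t k x = 0"
  by (simp add: bump_def flat_exp_def)

lemma bump_plus_1 [simp]: "bump t k (x + 1) = bump t k x"
  by (simp add: bump_def)

lemma smooth_on_bump: "smooth_on (bump t k) S"
  unfolding bump_def[abs_def]
  by (intro smooth_on_mult smooth_on_const smooth_on_sin_dist smooth_on_diff
      smooth_on_compose[OF smooth_on_flat_exp])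

section \<open>Integrals over the circle\<close>

definition circle_integral :: "(real \<Rightarrow> real) \<Rightarrow> real" where
  "circle_integral h = set_lebesgue_integral lborel {0..<1} h"

lemma continuous_imp_circle_integrable:
  fixes h :: "real \<Rightarrow> real"
  assumes "continuous_on UNIV h"
  shows "set_integrable lborel {0..<1} h"
proof -
  have "set_integrable lborel {0..1} h"
    by (rule borel_integrable_atLeastAtMost') (rule continuous_on_subset[OF assms], simp)
  then show ?thesis by (rule set_integrable_subset) auto
qed

lemma circle_integral_add:
  assumes "continuous_on UNIV g" "continuous_on UNIV h"
  shows "circle_integral (\<lambda>x. g x + h x) = circle_integral g + circle_integral h"
  unfolding circle_integral_def
  by (rule set_integral_add) (auto intro: continuous_imp_circle_integrable assms)

lemma circle_integral_mono:
  assumes "continuous_on UNIV g" "continuous_on UNIV h" "\<And>x. g x \<le> h x"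
  shows "circle_integral g \<le> circle_integral h"
  unfolding circle_integral_def
  by (rule set_integral_mono) (auto intro: continuous_imp_circle_integrable assms)

text \<open>A continuous nonnegative function with integral 0 vanishes on all of
  \<open>[0, 1]\<close>; periodicity moves the positive value at \<open>s\<close> to
  \<open>frac s\<close> in that interval.\<close>

lemma circle_integral_pos:
  assumes h: "continuous_on UNIV h" "\<And>x. 0 \<le> h x" "periodic_fun_simple' h" and "h s > 0"
  shows "circle_integral h > 0"
proof -
  interpret periodic_fun_simple' h by fact
  have hf: "h (frac s) > 0"
    using \<open>h s > 0\<close> minus_of_int[of s "\<lfloor>s\<rfloor>"] by (simp add: frac_def)
  have "integral {0..<1} h = integral {0..1} h"
    by (rule integral_spike_set) (auto intro: negligible_subset[of "{1}"])
  then have eq: "circle_integral h = integral {0..1} h"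
    unfolding circle_integral_def
    by (subst set_borel_integral_eq_integral) (auto intro: continuous_imp_circle_integrable h)
  have c: "continuous_on {0..1} h" using h(1) continuous_on_subset by blast
  have "integral {0..1} h \<noteq> 0"
    using integral_cbox_eq_0_iff[of "0::real" 1 h] c h(2) hf frac_lt_1[of s] by fastforce
  moreover have "integral {0..1} h \<ge> 0"
    using h(2) by (auto intro!: integral_nonneg integrable_continuous_real c)
  ultimately show ?thesis using eq by linarith
qed

lemma circle_integral_bump_pos: "circle_integral (bump t k) > 0"
proof (rule circle_integral_pos)
  \<comment> \<open>Half the cutoff: where \<open>sin_dist t\<close> takes the value
    \<open>b\<close>, both nonconstant factors of the bump are positive. Solving for that point
    gives the arcsine below.\<close>
  define b :: real where "b = (1 / 2) ^ k / 2"
  have b: "0 < b" "b < (1 / 2) ^ k" by (auto simp: b_def)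
  have "(1 / 2 :: real) ^ k \<le> 1" by (simp add: power_le_one)
  then have b1: "0 \<le> sqrt b" "sqrt b \<le> 1" using b by auto
  have "sin_dist t (t + arcsin (sqrt b) / pi) = b"
    using b sin_arcsin[of "sqrt b"] b1 by (simp add: sin_dist_def del: sin_arcsin)
  then show "bump t k (t + arcsin (sqrt b) / pi) > 0"
    using b by (simp add: bump_def flat_exp_def)
qed (auto intro!: smooth_on_imp_continuous_on smooth_on_bump bump_nonneg periodic_fun_simple'.intro)

section \<open>Factors that vanish at the first points of the sequence\<close>

text \<open>A smooth periodic approximation, as \<open>M\<close> grows, to the indicator of the
  complement of \<open>a 1, ..., a n\<close> modulo integers. A factor is 0 at its own point for
  positive and zero \<open>M\<close> alike, since \<open>1 ^ M = 1\<close>; elsewhere it tends to 1,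
  as the base lies in \<open>[0, 1)\<close>.\<close>

definition avoid :: "(nat \<Rightarrow> real) \<Rightarrow> nat \<Rightarrow> nat \<Rightarrow> real \<Rightarrow> real" where
  "avoid a n M x = (\<Prod>j=1..n. 1 - (1 - sin_dist (a j) x) ^ M)"

lemma avoid_nonneg: "0 \<le> avoid a n M x"
  and avoid_le_1: "avoid a n M x \<le> 1"
  unfolding avoid_def
  by (auto intro!: prod_nonneg prod_le_1 power_le_one simp: sin_dist_nonneg sin_dist_le_1)

lemma avoid_eq_0: "1 \<le> j \<Longrightarrow> j \<le> n \<Longrightarrow> avoid a n M (a j) = 0"
  by (auto simp: avoid_def intro!: bexI[of _ j])

lemma smooth_on_avoid: "smooth_on (avoid a n M) S"
  unfolding avoid_def[abs_def]
  by (intro smooth_on_prod smooth_on_diff smooth_on_const smooth_on_power smooth_on_sin_dist)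

lemma avoid_tendsto_1:
  assumes "\<And>j. j \<in> {1..n} \<Longrightarrow> x - a j \<notin> \<int>"
  shows "(\<lambda>M. avoid a n M x) \<longlonglongrightarrow> 1"
proof -
  have "(\<lambda>M. avoid a n M x) \<longlonglongrightarrow> (\<Prod>j=1..n. 1 - 0)"
    unfolding avoid_def
  proof (intro tendsto_prod tendsto_diff tendsto_const LIMSEQ_power_zero)
    fix j assume "j \<in> {1..n}"
    then have "sin_dist (a j) x \<noteq> 0" using assms by (simp add: sin_dist_eq_0_iff)
    then show "norm (1 - sin_dist (a j) x) < 1"
      using sin_dist_nonneg[of "a j" x] sin_dist_le_1[of "a j" x] by auto
  qed
  then show ?thesis by simp
qed

text \<open>Dominated convergence with majorant \<open>norm (g x)\<close> on the fundamental domain: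
  the factors lie in \<open>[0, 1]\<close> and tend to 1 almost everywhere. Thus forcing zeros at
  finitely many points costs arbitrarily little integral.\<close>

lemma circle_integral_avoid_tendsto:
  assumes g: "continuous_on UNIV g"
  shows "(\<lambda>M. circle_integral (\<lambda>x. g x * avoid a n M x)) \<longlonglongrightarrow> circle_integral g"
  unfolding circle_integral_def set_lebesgue_integral_def
proof (rule integral_dominated_convergence)
  have gi: "integrable lborel (\<lambda>x. indicator {0..<1} x *\<^sub>R g x)"
    using continuous_imp_circle_integrable[OF g] by (simp add: set_integrable_def)
  then show "integrable lborel (\<lambda>x. norm (indicator {0..<1} x *\<^sub>R g x))"
    by (rule integrable_norm)
  show "(\<lambda>x. indicator {0..<1} x *\<^sub>R g x) \<in> borel_measurable lborel"
    using gi by auto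
  show "(\<lambda>x. indicator {0..<1} x *\<^sub>R (g x * avoid a n M x)) \<in> borel_measurable lborel" for M
  proof -
    have "set_integrable lborel {0..<1} (\<lambda>x. g x * avoid a n M x)"
      by (intro continuous_imp_circle_integrable continuous_on_mult g
          smooth_on_imp_continuous_on smooth_on_avoid)
    then show ?thesis by (auto simp: set_integrable_def)
  qed
  show "AE x in lborel. norm (indicator {0..<1} x *\<^sub>R (g x * avoid a n M x))
      \<le> norm (indicator {0..<1} x *\<^sub>R g x)" for M
    by (rule AE_I2) (auto simp: indicator_def abs_mult avoid_nonneg avoid_le_1 intro!: mult_left_le)
  show "AE x in lborel. (\<lambda>M. indicator {0..<1} x *\<^sub>R (g x * avoid a n M x))
      \<longlonglongrightarrow> indicator {0..<1} x *\<^sub>R g x"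
  proof (rule AE_I')
    \<comment> \<open>All integer translates of the forbidden points: a countable set, hence null,
      outside which \<open>avoid\<close> tends to 1.\<close>
    define Z where "Z = (\<Union>j\<in>{1..n}. (\<lambda>m. of_int m + a j) ` (UNIV :: int set))"
    show "Z \<in> null_sets lborel"
      unfolding Z_def by (intro countable_imp_null_set_lborel countable_UN) auto
    have "(\<lambda>M. indicator {0..<1} x *\<^sub>R (g x * avoid a n M x))
      \<longlonglongrightarrow> indicator {0..<1} x *\<^sub>R g x" if "x \<notin> Z" for x
    proof -
      have "x - a j \<notin> \<int>" if "j \<in> {1..n}" for j
      proof
        assume "x - a j \<in> \<int>"
        then obtain m where "x - a j = of_int m" by (rule Ints_cases)
        then have "x = of_int m + a j" by simp
        with \<open>x \<notin> Z\<close> that show False unfolding Z_def by blast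
      qed
      then have "(\<lambda>M. avoid a n M x) \<longlonglongrightarrow> 1" by (rule avoid_tendsto_1)
      then have "(\<lambda>M. indicator {0..<1} x *\<^sub>R (g x * avoid a n M x))
          \<longlonglongrightarrow> indicator {0..<1} x *\<^sub>R (g x * 1)"
        by (intro tendsto_intros)
      then show ?thesis by simp
    qed
    then show "{x \<in> space lborel. \<not> (\<lambda>M. indicator {0..<1} x *\<^sub>R (g x * avoid a n M x))
      \<longlonglongrightarrow> indicator {0..<1} x *\<^sub>R g x} \<subseteq> Z"
      by blast
  qed
qed

section \<open>The series of bumps\<close>

text \<open>Kept signed, without absolute value: it is additive, and the contributions of the later
  bumps all have the same sign.\<close>

definition discrepancy :: "(nat \<Rightarrow> real) \<Rightarrow> nat \<Rightarrow> (real \<Rightarrow> real) \<Rightarrow> real" where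
  "discrepancy a n h = (\<Sum>j=1..n. h (a j)) / n - circle_integral h"

lemma discrepancy_add:
  assumes "continuous_on UNIV g" "continuous_on UNIV h"
  shows "discrepancy a n (\<lambda>x. g x + h x) = discrepancy a n g + discrepancy a n h"
  by (simp add: discrepancy_def circle_integral_add[OF assms] sum.distrib add_divide_distrib)

text \<open>The average of \<open>h\<close> over the sample is 0, so only minus its integral
  remains, and that integral dominates the one of \<open>g\<close>.\<close>

lemma discrepancy_le_neg_integral:
  assumes "continuous_on UNIV g" "continuous_on UNIV h" "\<And>x. g x \<le> h x"
    and "\<And>j. j \<in> {1..n} \<Longrightarrow> h (a j) = 0"
  shows "discrepancy a n h \<le> - circle_integral g"
  using circle_integral_mono[OF assms(1-3)] assms(4) by (simp add: discrepancy_def)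

text \<open>Regularity of the series follows from domination by the bumps alone. The zeros at points
  of \<open>a\<close> enter only in the discrepancy estimate, so the \<open>g k\<close> stay
  abstract here.\<close>

context
  fixes t :: real and g :: "nat \<Rightarrow> real \<Rightarrow> real"
  assumes smooth: "\<And>k. smooth_on (g k) UNIV"
    and periodic: "\<And>k. periodic_fun_simple' (g k)"
    and nonneg: "\<And>k x. 0 \<le> g k x"
    and le_bump: "\<And>k x. g k x \<le> bump t k x"
begin

lemma bump_series_le: "g k x \<le> (1 / 2) ^ k * sin_dist t x"
  using le_bump[of k x] bump_le[of t k x] by linarith

lemma bump_series_summable: "summable (\<lambda>k. g k x)"
  by (rule summable_comparison_test'[of "\<lambda>k. (1 / 2) ^ k * sin_dist t x" 0])
    (auto intro!: summable_mult2 summable_geometric simp: nonneg bump_series_le)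

lemma bump_series_periodic: "periodic_fun_simple' (\<lambda>x. \<Sum>k. g k x)"
proof
  show "(\<Sum>k. g k (x + 1)) = (\<Sum>k. g k x)" for x
    using periodic[unfolded periodic_fun_simple'_def] by simp
qed

lemma smooth_on_partial_sum: "smooth_on (\<lambda>x. \<Sum>k<N. g k x) S"
proof (induction N)
  case (Suc N)
  then show ?case
    using smooth_on_add[OF _ smooth_on_subset[OF smooth]] by simp
qed (simp add: smooth_on_const)

lemma bump_series_nonneg: "0 \<le> (\<Sum>k. g k x)"
  by (rule suminf_nonneg[OF bump_series_summable nonneg])

lemma bump_series_le_sin_dist: "(\<Sum>k. g k x) \<le> 2 * sin_dist t x"
proof -
  have "(\<Sum>k. g k x) \<le> (\<Sum>k. (1 / 2) ^ k * sin_dist t x)"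
    by (intro suminf_le bump_series_le bump_series_summable summable_mult2 summable_geometric) simp
  also have "\<dots> = 2 * sin_dist t x"
    by (subst suminf_mult2[symmetric]) (auto simp: suminf_geometric)
  finally show ?thesis .
qed

text \<open>Away from \<open>t\<close> the series is locally finite: on the open set where
  \<open>sin_dist t\<close> exceeds \<open>(1 / 2) ^ N\<close>, all terms from the
  \<open>N\<close>-th on vanish and a smooth partial sum is left.\<close>

lemma bump_series_smooth_at_nonzero:
  assumes "sin_dist t x \<noteq> 0"
  obtains U where "open U" "x \<in> U" "smooth_on (\<lambda>x. \<Sum>k. g k x) U"
proof -
  have "0 < sin_dist t x" using assms sin_dist_nonneg[of t x] by linarith
  then obtain N where N: "(1 / 2) ^ N < sin_dist t x"
    using real_arch_pow_inv[of "sin_dist t x" "1 / 2"] by auto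
  define U where "U = {y. (1 / 2) ^ N < sin_dist t y}"
  have "open U"
    unfolding U_def by (intro open_Collect_less continuous_on_const continuous_on_sin_dist)
  moreover have "smooth_on (\<lambda>x. \<Sum>k. g k x) U"
  proof (rule smooth_on_cong[OF smooth_on_partial_sum[of N] \<open>open U\<close>])
    fix y assume "y \<in> U"
    have "g k y = 0" if "N \<le> k" for k
    proof -
      have "(1 / 2 :: real) ^ k \<le> (1 / 2) ^ N" using that by (intro power_decreasing) auto
      also have "\<dots> \<le> sin_dist t y" using \<open>y \<in> U\<close> by (simp add: U_def)
      finally have "bump t k y = 0" by (rule bump_eq_0)
      then show ?thesis using nonneg[of k y] le_bump[of k y] by simp
    qed
    then show "(\<Sum>k<N. g k y) = (\<Sum>k. g k y)"
      by (intro suminf_finite[symmetric]) auto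
  qed
  ultimately show thesis using that N by (simp add: U_def)
qed

text \<open>At \<open>t\<close> the series is squeezed between 0 and \<open>2 * sin_dist t\<close>,
  which vanishes there together with its derivative; hence the difference quotients tend to
  0.\<close>

lemma bump_series_has_derivative_0:
  assumes x: "sin_dist t x = 0"
  shows "((\<lambda>x. \<Sum>k. g k x) has_field_derivative 0) (at x)"
proof -
  have z: "(\<Sum>k. g k x) = 0"
    using bump_series_nonneg[of x] bump_series_le_sin_dist[of x] x by simp
  have "(sin_dist t has_field_derivative 0) (at x)"
    using sin_dist_has_derivative[of t x] x by (simp add: sin_dist_def)
  then have "((\<lambda>d. sin_dist t (x + d) / d) \<longlongrightarrow> 0) (at 0)"
    by (simp add: DERIV_def x)
  then have lim: "((\<lambda>d. 2 * norm (sin_dist t (x + d) / d)) \<longlongrightarrow> 0) (at 0)"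
    by (intro tendsto_mult_right_zero tendsto_norm_zero)
  have bound: "norm ((\<Sum>k. g k (x + d)) / d) \<le> 2 * norm (sin_dist t (x + d) / d)" for d
    using divide_right_mono[OF bump_series_le_sin_dist[of "x + d"], of "\<bar>d\<bar>"]
      bump_series_nonneg[of "x + d"] sin_dist_nonneg[of t "x + d"]
    by (simp add: abs_divide)
  have "((\<lambda>d. (\<Sum>k. g k (x + d)) / d) \<longlongrightarrow> 0) (at 0)"
    by (rule Lim_null_comparison[OF always_eventually[OF allI[OF bound]] lim])
  then show ?thesis by (simp add: DERIV_def z)
qed

lemma bump_series_differentiable: "(\<lambda>x. \<Sum>k. g k x) differentiable (at x)"
proof (cases "sin_dist t x = 0")
  case True
  then show ?thesis
    using bump_series_has_derivative_0 real_differentiable_def by blast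
next
  case False
  then obtain U where "open U" "x \<in> U" "smooth_on (\<lambda>x. \<Sum>k. g k x) U"
    by (rule bump_series_smooth_at_nonzero)
  then show ?thesis by (simp add: smooth_on_imp_differentiable)
qed

lemma bump_series_continuous: "continuous_on UNIV (\<lambda>x. \<Sum>k. g k x)"
  by (auto intro!: continuous_at_imp_continuous_on differentiable_imp_continuous_within
      bump_series_differentiable)

lemma bump_series_C_infinity:
  "C_infinity_on (\<lambda>x. complex_of_real (\<Sum>k. g k x)) (punctured_circle t)"
  unfolding C_infinity_on_def
proof (intro allI ballI)
  fix m x assume "x \<in> punctured_circle t"
  then have "sin_dist t x \<noteq> 0" by (simp add: punctured_circle_def sin_dist_eq_0_iff)
  then obtain U where U: "open U" "x \<in> U" "smooth_on (\<lambda>x. \<Sum>k. g k x) U"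
    by (rule bump_series_smooth_at_nonzero)
  then show "nth_vector_derivative m (\<lambda>x. complex_of_real (\<Sum>k. g k x)) differentiable (at x)"
    using smooth_on_imp_C_infinity_on[OF smooth_on_of_real] by (auto simp: C_infinity_on_def)
qed

text \<open>Split the series at \<open>m\<close>. The tail \<open>R\<close> vanishes at the first
  \<open>n\<close> points and, its terms being nonnegative, dominates its first term
  \<open>g m\<close>; its discrepancy is therefore at most minus the integral of
  \<open>g m\<close>.\<close>

lemma bump_series_discrepancy_le:
  assumes vanish: "\<And>k j. m \<le> k \<Longrightarrow> j \<in> {1..n} \<Longrightarrow> g k (a j) = 0"
  shows "discrepancy a n (\<lambda>x. \<Sum>k. g k x)
    \<le> discrepancy a n (\<lambda>x. \<Sum>k<m. g k x) - circle_integral (g m)"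
proof -
  define R where "R x = (\<Sum>k. g k x) - (\<Sum>k<m. g k x)" for x
  have R: "R x = (\<Sum>k. g (k + m) x)" for x
    using suminf_split_initial_segment[OF bump_series_summable[of x], of m] by (simp add: R_def)
  have cont: "continuous_on UNIV (\<lambda>x. \<Sum>k<m. g k x)"
    by (rule smooth_on_imp_continuous_on[OF smooth_on_partial_sum])
  then have contR: "continuous_on UNIV R"
    unfolding R_def by (intro continuous_on_diff bump_series_continuous)
  have "discrepancy a n R \<le> - circle_integral (g m)"
  proof (rule discrepancy_le_neg_integral[OF smooth_on_imp_continuous_on[OF smooth] contR])
    show "g m x \<le> R x" for x
      \<comment> \<open>Index 0 of the shifted series is the term \<open>g m\<close>.\<close>
      using sum_le_suminf[of "\<lambda>k. g (k + m) x" "{0}"]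
        summable_ignore_initial_segment[OF bump_series_summable[of x], of m]
      by (simp add: R nonneg)
    show "R (a j) = 0" if "j \<in> {1..n}" for j
      using vanish that by (simp add: R)
  qed
  moreover have "discrepancy a n (\<lambda>x. \<Sum>k. g k x) =
      discrepancy a n (\<lambda>x. \<Sum>k<m. g k x) + discrepancy a n R"
    using discrepancy_add[OF cont contR] by (simp add: R_def)
  ultimately show ?thesis by simp
qed

end

section \<open>Inductive choice of the indices and bumps\<close>

text \<open>The order of choice matters: the integral \<open>b\<close> of the full bump does not
  depend on \<open>n\<close>, so \<open>n\<close> is chosen first, with \<open>f n\<close> small
  against \<open>b\<close>, and only then \<open>M\<close>, depending on \<open>n\<close>, so that
  avoiding \<open>n\<close> points keeps more than half of \<open>b\<close>.\<close>

lemma exists_avoiding_bump: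
  fixes f :: "nat \<Rightarrow> real"
  assumes "f \<longlonglongrightarrow> 0" and G: "\<forall>\<^sub>F n in sequentially. \<bar>discrepancy a n G\<bar> < f n"
  shows "\<exists>n>N. \<exists>g. smooth_on g UNIV \<and> periodic_fun_simple' g \<and>
    (\<forall>x. 0 \<le> g x \<and> g x \<le> bump t k x) \<and> (\<forall>j\<in>{1..n}. g (a j) = 0) \<and>
    \<bar>discrepancy a n G\<bar> < f n \<and> 2 * f n \<le> circle_integral g"
proof -
  define b where "b = circle_integral (bump t k)"
  have b: "b > 0" using circle_integral_bump_pos by (simp add: b_def)
  \<comment> \<open>With the bound \<open>b / 4\<close>, twice \<open>f n\<close> stays below
    \<open>b / 2\<close>, the mass that survives the avoidance.\<close>
  have "\<forall>\<^sub>F n in sequentially. f n < b / 4"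
    using order_tendstoD(2)[OF assms(1), of "b / 4"] b by simp
  with G have "\<forall>\<^sub>F n in sequentially. n > N \<and> \<bar>discrepancy a n G\<bar> < f n \<and> f n < b / 4"
    using eventually_gt_at_top[of N] by eventually_elim auto
  then obtain n where n: "n > N" "\<bar>discrepancy a n G\<bar> < f n" "f n < b / 4"
    by (auto dest: eventually_happens)
  have "\<forall>\<^sub>F M in sequentially. circle_integral (\<lambda>x. bump t k x * avoid a n M x) > b / 2"
    using circle_integral_avoid_tendsto[OF smooth_on_imp_continuous_on[OF smooth_on_bump]] b
    by (intro order_tendstoD) (auto simp: b_def)
  then obtain M where M: "circle_integral (\<lambda>x. bump t k x * avoid a n M x) > b / 2"
    by (auto dest: eventually_happens)
  show ?thesis
  proof (intro exI[of _ n] exI[of _ "\<lambda>x. bump t k x * avoid a n M x"] conjI allI ballI)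
    show "smooth_on (\<lambda>x. bump t k x * avoid a n M x) UNIV"
      by (intro smooth_on_mult smooth_on_bump smooth_on_avoid)
    show "periodic_fun_simple' (\<lambda>x. bump t k x * avoid a n M x)"
      by standard (simp add: avoid_def)
    show "0 \<le> bump t k x * avoid a n M x" "bump t k x * avoid a n M x \<le> bump t k x" for x
      by (auto intro!: mult_left_le simp: bump_nonneg avoid_nonneg avoid_le_1)
    show "bump t k (a j) * avoid a n M (a j) = 0" if "j \<in> {1..n}" for j
      using that by (simp add: avoid_eq_0)
    show "2 * f n \<le> circle_integral (\<lambda>x. bump t k x * avoid a n M x)"
      using M n(3) by simp
  qed (use n in simp_all)
qed

lemma exists_avoiding_bumps:
  fixes f :: "nat \<Rightarrow> real"
  assumes f: "f \<longlonglongrightarrow> 0"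
    and small: "\<And>G. smooth_on G UNIV \<Longrightarrow> periodic_fun_simple' G \<Longrightarrow>
      \<forall>\<^sub>F n in sequentially. \<bar>discrepancy a n G\<bar> < f n"
  shows "\<exists>n g. strict_mono n \<and> (\<forall>k. n k \<ge> 1 \<and> smooth_on (g k) UNIV \<and> periodic_fun_simple' (g k) \<and>
    (\<forall>x. 0 \<le> g k x \<and> g k x \<le> bump t k x) \<and> (\<forall>j\<in>{1..n k}. g k (a j) = 0) \<and>
    \<bar>discrepancy a (n k) (\<lambda>x. \<Sum>i<k. g i x)\<bar> < f (n k) \<and> 2 * f (n k) \<le> circle_integral (g k))"
proof -
  \<comment> \<open>The state carries the sum \<open>G\<close> of the earlier bumps besides
    \<open>n\<close> and \<open>g\<close>, because the next index must be large enough for the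
    discrepancy of that sum.\<close>
  define P where "P k = (\<lambda>(n, g, G). n \<ge> (1::nat) \<and> smooth_on g UNIV \<and> periodic_fun_simple' g \<and>
    smooth_on G UNIV \<and> periodic_fun_simple' G \<and> (\<forall>x. 0 \<le> g x \<and> g x \<le> bump t k x) \<and>
    (\<forall>j\<in>{1..n}. g (a j) = 0) \<and> \<bar>discrepancy a n G\<bar> < f n \<and> 2 * f n \<le> circle_integral g)"
    for k
  have P_step: "\<exists>n g. n > N \<and> P k (n, g, G)"
    if G: "smooth_on G UNIV" "periodic_fun_simple' G" for N k G
  proof -
    obtain n g where ng: "n > N" "smooth_on g UNIV \<and> periodic_fun_simple' g \<and>
      (\<forall>x. 0 \<le> g x \<and> g x \<le> bump t k x) \<and> (\<forall>j\<in>{1..n}. g (a j) = 0) \<and>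
      \<bar>discrepancy a n G\<bar> < f n \<and> 2 * f n \<le> circle_integral g"
      using exists_avoiding_bump[OF f small[OF G], of N t k] by blast
    with G have "P k (n, g, G)" by (simp add: P_def)
    with ng(1) show ?thesis by blast
  qed
  \<comment> \<open>Dependent choice fixes only the relation between consecutive states; the clause
    for \<open>k = 0\<close> starts the recursion of \<open>G\<close> at the empty sum.\<close>
  have "\<exists>s. \<forall>k. (P k (s k) \<and> (k = 0 \<longrightarrow> snd (snd (s k)) = (\<lambda>_. 0))) \<and>
    (case (s k, s (Suc k)) of ((n, g, G), (n', g', G')) \<Rightarrow> n < n' \<and> G' = (\<lambda>x. G x + g x))"
  proof (intro dependent_nat_choice)
    obtain n g where "P 0 (n, g, \<lambda>_. 0)"
      using P_step[of "\<lambda>_. 0" 0 0] by (auto intro: smooth_on_const periodic_fun_simple'.intro)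
    then show "\<exists>s. P 0 s \<and> (0 = 0 \<longrightarrow> snd (snd s) = (\<lambda>_. 0))"
      by (intro exI[of _ "(n, g, \<lambda>_. 0)"]) simp
  next
    fix s k assume "P k s \<and> (k = 0 \<longrightarrow> snd (snd s) = (\<lambda>_. 0))"
    then obtain n g G where s: "s = (n, g, G)" "P k (n, g, G)" by (cases s) auto
    then have "smooth_on (\<lambda>x. G x + g x) UNIV" "periodic_fun_simple' (\<lambda>x. G x + g x)"
      by (auto simp: P_def periodic_fun_simple'_def intro!: smooth_on_add)
    then obtain n' g' where "n' > n" "P (Suc k) (n', g', \<lambda>x. G x + g x)"
      using P_step by blast
    then show "\<exists>s'. (P (Suc k) s' \<and> (Suc k = 0 \<longrightarrow> snd (snd s') = (\<lambda>_. 0))) \<and>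
        (case (s, s') of ((n, g, G), (n', g', G')) \<Rightarrow> n < n' \<and> G' = (\<lambda>x. G x + g x))"
      using s by (intro exI[of _ "(n', g', \<lambda>x. G x + g x)"]) simp
  qed
  then obtain s where s: "\<forall>k. (P k (s k) \<and> (k = 0 \<longrightarrow> snd (snd (s k)) = (\<lambda>_. 0))) \<and>
    (case (s k, s (Suc k)) of ((n, g, G), (n', g', G')) \<Rightarrow> n < n' \<and> G' = (\<lambda>x. G x + g x))"
    by (rule exE)
  define n g G where "n k = fst (s k)" and "g k = fst (snd (s k))" and "G k = snd (snd (s k))" for k
  have P: "P k (n k, g k, G k)" for k using s by (simp add: n_def g_def G_def)
  have step: "n k < n (Suc k)" "G (Suc k) = (\<lambda>x. G k x + g k x)" for k
    using spec[OF s, of k] by (auto simp: n_def g_def G_def split: prod.splits)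
  have G_0: "G 0 = (\<lambda>_. 0)"
    using s by (simp add: G_def)
  have "G k = (\<lambda>x. \<Sum>i<k. g i x)" for k
    by (induction k) (simp_all add: G_0 step)
  with P have "P k (n k, g k, \<lambda>x. \<Sum>i<k. g i x)" for k by metis
  then show ?thesis
    by (intro exI[of _ n] exI[of _ g]) (auto simp: P_def strict_mono_Suc_iff step)
qed

section \<open>Passage to complex values and conclusion\<close>

lemma norm_discrepancy_of_real:
  "norm ((\<Sum>j=1..n. complex_of_real (h (a j))) / of_nat n
    - set_lebesgue_integral lborel {0..<1} (\<lambda>x. complex_of_real (h x))) = \<bar>discrepancy a n h\<bar>"
proof -
  have "(\<Sum>j=1..n. complex_of_real (h (a j))) / of_nat n
    - set_lebesgue_integral lborel {0..<1} (\<lambda>x. complex_of_real (h x)) = of_real (discrepancy a n h)"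
    by (simp add: discrepancy_def circle_integral_def set_integral_complex_of_real)
  then show ?thesis by (simp only: norm_of_real)
qed

theorem theorem7:
  fixes a :: "nat \<Rightarrow> real" and t :: real and f :: "nat \<Rightarrow> real"
  assumes f_pos: "\<And>n. n \<ge> 1 \<Longrightarrow> f n > 0"
    and f_decreasing: "antimono_on {1..} f"
    and f_tendsto_0: "f \<longlonglongrightarrow> 0"
  shows "\<exists>h :: real \<Rightarrow> complex.
    periodic_fun_simple' h \<and>
    continuous_on UNIV h \<and>
    (\<forall>x. h differentiable (at x)) \<and>
    C_infinity_on h (punctured_circle t) \<and>
    infinite {n::nat. n \<ge> 1 \<and>
      norm ((\<Sum>j=1..n. h (a j)) / of_nat n - set_lebesgue_integral lborel {0..<1} h) \<ge> f n}"
proof -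
  \<comment> \<open>It suffices to find a real-valued \<open>h\<close>: regarded as complex, it
    keeps its regularity and the modulus of its discrepancy, and continuity follows from
    differentiability.\<close>
  have goal: ?thesis
    if "periodic_fun_simple' h" "\<And>x. h differentiable (at x)"
      "C_infinity_on (\<lambda>x. complex_of_real (h x)) (punctured_circle t)"
      "infinite {n. n \<ge> 1 \<and> f n \<le> \<bar>discrepancy a n h\<bar>}" for h
  proof (intro exI[of _ "\<lambda>x. complex_of_real (h x)"] conjI allI)
    show d: "(\<lambda>x. complex_of_real (h x)) differentiable (at x)" for x
      using that(2)[of x] has_vector_derivative_of_real[of h _ "at x"]
      by (auto simp: real_differentiable_def intro: differentiableI_vector)
    show "continuous_on UNIV (\<lambda>x. complex_of_real (h x))"
      by (intro continuous_at_imp_continuous_on ballI differentiable_imp_continuous_within d)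
  qed (use that in \<open>simp_all only: periodic_fun_simple'_def norm_discrepancy_of_real not_False_eq_True simp_thms\<close>)
  show ?thesis
  \<comment> \<open>Either some function smooth on the whole circle already violates the bound
    infinitely often, or each such function, in particular every partial sum of bumps, eventually
    has discrepancy below \<open>f n\<close>.\<close>
  proof (cases "\<exists>G. smooth_on G UNIV \<and> periodic_fun_simple' G \<and>
      \<not> (\<forall>\<^sub>F n in sequentially. \<bar>discrepancy a n G\<bar> < f n)")
    case True
    then obtain G where G: "smooth_on G UNIV" "periodic_fun_simple' G"
      "\<not> (\<forall>\<^sub>F n in sequentially. \<bar>discrepancy a n G\<bar> < f n)"
      by blast
    have "infinite {n. n \<ge> 1 \<and> f n \<le> \<bar>discrepancy a n G\<bar>}"
    proof
      assume "finite {n. n \<ge> 1 \<and> f n \<le> \<bar>discrepancy a n G\<bar>}"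
      then have "\<forall>\<^sub>F n in sequentially. \<not> (n \<ge> 1 \<and> f n \<le> \<bar>discrepancy a n G\<bar>)"
        by (simp add: eventually_cofinite flip: cofinite_eq_sequentially)
      then have "\<forall>\<^sub>F n in sequentially. \<bar>discrepancy a n G\<bar> < f n"
        using eventually_ge_at_top[of 1] by eventually_elim auto
      with G(3) show False by blast
    qed
    moreover have "C_infinity_on (\<lambda>x. complex_of_real (G x)) (punctured_circle t)"
      using smooth_on_imp_C_infinity_on[OF smooth_on_of_real[OF G(1)] open_UNIV]
      by (simp add: C_infinity_on_def)
    ultimately show ?thesis
      using G by (intro goal[of G]) (auto intro: smooth_on_imp_differentiable)
  next
    case False
    have small: "\<forall>\<^sub>F n in sequentially. \<bar>discrepancy a n G\<bar> < f n"
      if "smooth_on G UNIV" "periodic_fun_simple' G" for G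
      using False that by blast
    obtain n g where "strict_mono n" and "\<forall>k. n k \<ge> (1::nat) \<and> smooth_on (g k) UNIV \<and>
      periodic_fun_simple' (g k) \<and> (\<forall>x. 0 \<le> g k x \<and> g k x \<le> bump t k x) \<and>
      (\<forall>j\<in>{1..n k}. g k (a j) = 0) \<and> \<bar>discrepancy a (n k) (\<lambda>x. \<Sum>i<k. g i x)\<bar> < f (n k) \<and>
      2 * f (n k) \<le> circle_integral (g k)"
      using exists_avoiding_bumps[OF f_tendsto_0 small, of t] by blast
    then have g: "strict_mono n" "\<And>k. n k \<ge> 1"
      "\<And>k. smooth_on (g k) UNIV" "\<And>k. periodic_fun_simple' (g k)"
      "\<And>k x. 0 \<le> g k x" "\<And>k x. g k x \<le> bump t k x"
      "\<And>k j. j \<in> {1..n k} \<Longrightarrow> g k (a j) = 0"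
      "\<And>k. \<bar>discrepancy a (n k) (\<lambda>x. \<Sum>i<k. g i x)\<bar> < f (n k)"
      "\<And>k. 2 * f (n k) \<le> circle_integral (g k)"
      by blast+
    note series = g(3-6)
    have "f (n k) \<le> \<bar>discrepancy a (n k) (\<lambda>x. \<Sum>i. g i x)\<bar>" for k
    proof -
      \<comment> \<open>For \<open>i\<close> at least \<open>k\<close>, \<open>g i\<close> vanishes
        at the first \<open>n i\<close> points, which include the first \<open>n k\<close> because
        \<open>n\<close> is increasing.\<close>
      have "g i (a j) = 0" if "k \<le> i" "j \<in> {1..n k}" for i j
        using that g(7)[of j i] monoD[OF strict_mono_mono[OF g(1)] \<open>k \<le> i\<close>] by auto
      from bump_series_discrepancy_le[where g = g, OF series this]
      have "discrepancy a (n k) (\<lambda>x. \<Sum>i. g i x)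
          \<le> discrepancy a (n k) (\<lambda>x. \<Sum>i<k. g i x) - circle_integral (g k)" .
      \<comment> \<open>The partial sum contributes less than \<open>f (n k)\<close> and the tail at
        most \<open>- 2 * f (n k)\<close>, so the total lies below \<open>- f (n k)\<close>. This is
        why the factor 2 was imposed.\<close>
      with g(8,9)[of k] show ?thesis by linarith
    qed
    then have "range n \<subseteq> {n. n \<ge> 1 \<and> f n \<le> \<bar>discrepancy a n (\<lambda>x. \<Sum>i. g i x)\<bar>}"
      using g(2) by auto
    moreover have "infinite (range n)"
      using g(1) by (simp add: range_inj_infinite strict_mono_imp_inj_on)
    ultimately have "infinite {n. n \<ge> 1 \<and> f n \<le> \<bar>discrepancy a n (\<lambda>x. \<Sum>i. g i x)\<bar>}"
      using finite_subset by blast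
    then show ?thesis
      using bump_series_periodic[where g = g, OF series]
        bump_series_differentiable[where g = g, OF series]
        bump_series_C_infinity[where g = g, OF series]
      by (rule goal[rotated 3])
  qed
qed

end
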